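(* Let $0<p<q\le1$ and let $\beta=\frac{q}{q-p}$ denote the conjugate exponent of $q/p$. Define, for scalar sequences $z=(z_k)_k$, $(\psi(z))_k=|z_k|^{1/p}\operatorname{sgn}(z_k)$. Then the mapping $\psi:\ell^{q/p}\to\ell^\beta$ is weakly (sequentially) continuous, i.e. if $z^n\to\bar z$ weakly in $\ell^{q/p}$, then $\psi(z^n)\to\psi(\bar z)$ weakly in $\ell^\beta$.
   Context: For $r>0$, $\ell^r$ is the space of real sequences $z$ with $\sum_k|z_k|^r<\infty$. The map $\psi$ sends $\ell^{q/p}$ into $\ell^q\subset\ell^\beta$. *)

theory Defs
  imports "HOL-Analysis.Analysis"
begin

text \<open>The exponent \<open>r\<close> is a real number, so the spaces are carriers inside the type of all real
  sequences rather than types. Everything is meant for \<open>r > 0\<close>; then \<open>0 powr r = 0\<close> is the usual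
  value, and \<open>lnorm r\<close> is a norm on \<open>lspace r\<close> if \<open>r \<ge> 1\<close> and a quasi-norm otherwise.\<close>

definition lspace :: "real \<Rightarrow> (nat \<Rightarrow> real) set" where
  "lspace r = {z. summable (\<lambda>k. \<bar>z k\<bar> powr r)}"

definition lnorm :: "real \<Rightarrow> (nat \<Rightarrow> real) \<Rightarrow> real" where
  "lnorm r z = (\<Sum>k. \<bar>z k\<bar> powr r) powr (1 / r)"

text \<open>Members of the topological dual, with continuity expressed as boundedness as in
  \<^const>\<open>bounded_linear\<close>. A functional is a total function on sequences of which only
  the values on \<open>lspace r\<close> are constrained.\<close>

definition bounded_functional :: "real \<Rightarrow> ((nat \<Rightarrow> real) \<Rightarrow> real) \<Rightarrow> bool" where
  "bounded_functional r \<phi> \<longleftrightarrow>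
     (\<forall>x\<in>lspace r. \<forall>y\<in>lspace r. \<phi> (\<lambda>k. x k + y k) = \<phi> x + \<phi> y) \<and>
     (\<forall>c. \<forall>x\<in>lspace r. \<phi> (\<lambda>k. c * x k) = c * \<phi> x) \<and>
     (\<exists>C. \<forall>x\<in>lspace r. \<bar>\<phi> x\<bar> \<le> C * lnorm r x)"

definition weakly_converges :: "real \<Rightarrow> (nat \<Rightarrow> nat \<Rightarrow> real) \<Rightarrow> (nat \<Rightarrow> real) \<Rightarrow> bool" where
  "weakly_converges r Z z \<longleftrightarrow>
     (\<forall>n. Z n \<in> lspace r) \<and> z \<in> lspace r \<and>
     (\<forall>\<phi>. bounded_functional r \<phi> \<longrightarrow> (\<lambda>n. \<phi> (Z n)) \<longlonglongrightarrow> \<phi> z)"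

definition psi :: "real \<Rightarrow> (nat \<Rightarrow> real) \<Rightarrow> nat \<Rightarrow> real" where
  "psi p z = (\<lambda>k. \<bar>z k\<bar> powr (1 / p) * sgn (z k))"

end

theory Submission
  imports Defs
begin

text \<open>A weakly convergent sequence in \<open>\<ell>\<^bsup>q/p\<^esup>\<close> is norm bounded (a gliding hump argument, which needs neither
  completeness nor the Baire category theorem) and converges coordinatewise. Since
  \<open>\<bar>psi p z k\<bar> powr q = \<bar>z k\<bar> powr (q / p)\<close> and \<open>q \<le> 1\<close>, the images under \<open>psi p\<close> also converge
  coordinatewise and are bounded in \<open>\<ell>\<^sup>q\<close>, hence in \<open>\<ell>\<^sup>1\<close>. A bounded functional on \<open>\<ell>\<^sup>\<beta>\<close>, \<open>\<beta> > 1\<close>,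
  is given by a coefficient sequence that tends to zero, so it makes the tails of an
  \<open>\<ell>\<^sup>1\<close>-bounded family uniformly small.\<close>

section \<open>Young's inequality and the pairing of sequences with conjugate exponents\<close>

text \<open>Young's inequality with the weights \<open>1 / r\<close> and \<open>1 / s\<close>
  enlarged to 1. This crude additive form replaces Hoelder's inequality below, since only finiteness
  of the bounds matters.\<close>

lemma abs_mult_le_powr_add_powr:
  fixes a b r s :: real
  assumes "1 < r" "1 < s" "1 / r + 1 / s = 1"
  shows "\<bar>a * b\<bar> \<le> \<bar>a\<bar> powr r + \<bar>b\<bar> powr s"
proof -
  have "\<bar>a\<bar> * \<bar>b\<bar> \<le> \<bar>a\<bar> powr r / r + \<bar>b\<bar> powr s / s"
    using assms by (intro Youngs_inequality) auto
  also have "\<dots> \<le> \<bar>a\<bar> powr r / 1 + \<bar>b\<bar> powr s / 1"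
    using assms by (intro add_mono divide_left_mono) auto
  finally show ?thesis by (simp add: abs_mult)
qed

lemma summable_abs_mult_conjugate:
  fixes x y :: "nat \<Rightarrow> real"
  assumes rs: "1 < r" "1 < s" "1 / r + 1 / s = 1"
    and x: "summable (\<lambda>k. \<bar>x k\<bar> powr r)" and y: "summable (\<lambda>k. \<bar>y k\<bar> powr s)"
  shows "summable (\<lambda>k. \<bar>x k * y k\<bar>)"
    and "\<bar>\<Sum>k. x k * y k\<bar> \<le> (\<Sum>k. \<bar>x k\<bar> powr r) + (\<Sum>k. \<bar>y k\<bar> powr s)"
proof -
  note young = abs_mult_le_powr_add_powr[OF rs]
  have sxy: "summable (\<lambda>k. \<bar>x k\<bar> powr r + \<bar>y k\<bar> powr s)"
    using x y by (rule summable_add)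
  show s: "summable (\<lambda>k. \<bar>x k * y k\<bar>)"
    by (rule summable_comparison_test'[OF sxy, of 0]) (use young in simp)
  have "\<bar>\<Sum>k. x k * y k\<bar> \<le> (\<Sum>k. \<bar>x k * y k\<bar>)"
    using s by (rule summable_rabs)
  also have "\<dots> \<le> (\<Sum>k. \<bar>x k\<bar> powr r + \<bar>y k\<bar> powr s)"
    using young by (intro suminf_le s sxy)
  also have "\<dots> = (\<Sum>k. \<bar>x k\<bar> powr r) + (\<Sum>k. \<bar>y k\<bar> powr s)"
    using x y by (simp add: suminf_add)
  finally show "\<bar>\<Sum>k. x k * y k\<bar> \<le> (\<Sum>k. \<bar>x k\<bar> powr r) + (\<Sum>k. \<bar>y k\<bar> powr s)" .
qed

text \<open>Supplies the test functionals for weak convergence in \<open>lspace r\<close>. The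
  additive bound from Young's inequality becomes a bound by the norm through homogeneity: it is
  applied to \<open>x\<close> rescaled to power sum 1.\<close>

lemma bounded_functional_pairing:
  fixes y :: "nat \<Rightarrow> real"
  assumes rs: "1 < r" "1 < s" "1 / r + 1 / s = 1"
    and y: "y \<in> lspace s"
  shows "bounded_functional r (\<lambda>x. \<Sum>k. x k * y k)"
proof -
  have ys: "summable (\<lambda>k. \<bar>y k\<bar> powr s)" using y by (simp add: lspace_def)
  have sm: "summable (\<lambda>k. x k * y k)" if "x \<in> lspace r" for x
    using summable_abs_mult_conjugate(1)[OF rs _ ys, of x] that
    by (auto simp: lspace_def intro: summable_rabs_cancel)
  have bound: "\<bar>\<Sum>k. x k * y k\<bar> \<le> (1 + (\<Sum>k. \<bar>y k\<bar> powr s)) * lnorm r x" if x: "x \<in> lspace r" for x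
  \<comment> \<open>A sequence with power sum 0 cannot be rescaled; it vanishes, and both sides are
    0.\<close>
  proof (cases "(\<Sum>k. \<bar>x k\<bar> powr r) = 0")
    case True
    have "\<bar>x k\<bar> powr r = 0" for k
      using True x suminf_eq_zero_iff[of "\<lambda>k. \<bar>x k\<bar> powr r"] by (simp add: lspace_def)
    then show ?thesis by (simp add: lnorm_def)
  next
    case False
    define S where "S = (\<Sum>k. \<bar>x k\<bar> powr r)"
    have xs: "summable (\<lambda>k. \<bar>x k\<bar> powr r)" using x by (simp add: lspace_def)
    have "0 \<le> S" unfolding S_def by (intro suminf_nonneg xs) simp
    with False have S: "0 < S" by (simp add: S_def)
    define t where "t = S powr (1 / r)"
    have t: "0 < t" "t powr r = S" using S rs by (simp_all add: t_def powr_powr)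
    have eq: "\<bar>x k / t\<bar> powr r = \<bar>x k\<bar> powr r / S" for k
      using t by (simp add: powr_divide abs_divide)
    have xt: "summable (\<lambda>k. \<bar>x k / t\<bar> powr r)"
      unfolding eq by (intro summable_divide xs)
    have "\<bar>\<Sum>k. x k / t * y k\<bar> \<le> (\<Sum>k. \<bar>x k / t\<bar> powr r) + (\<Sum>k. \<bar>y k\<bar> powr s)"
      by (rule summable_abs_mult_conjugate(2)[OF rs xt ys])
    also have "(\<Sum>k. \<bar>x k / t\<bar> powr r) = 1"
      unfolding eq using S suminf_divide[OF xs, of S] by (simp add: S_def)
    also have "(\<Sum>k. x k / t * y k) = (\<Sum>k. x k * y k) / t"
      using suminf_divide[OF sm[OF x], of t] by simp
    finally have "\<bar>\<Sum>k. x k * y k\<bar> \<le> (1 + (\<Sum>k. \<bar>y k\<bar> powr s)) * t"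
      using t by (simp add: abs_divide divide_le_eq)
    then show ?thesis by (simp add: lnorm_def t_def S_def)
  qed
  show ?thesis
    unfolding bounded_functional_def
  proof (intro conjI ballI allI)
    fix x x' assume "x \<in> lspace r" "x' \<in> lspace r"
    then show "(\<Sum>k. (x k + x' k) * y k) = (\<Sum>k. x k * y k) + (\<Sum>k. x' k * y k)"
      by (simp add: suminf_add sm distrib_right)
  next
    fix c x assume "x \<in> lspace r"
    then show "(\<Sum>k. c * x k * y k) = c * (\<Sum>k. x k * y k)"
      by (simp add: suminf_mult sm mult.assoc)
  qed (use bound in blast)
qed

lemma finite_support_in_lspace:
  assumes "finite F" "\<And>k. k \<notin> F \<Longrightarrow> x k = 0"
  shows "x \<in> lspace r"
proof -
  have "summable (\<lambda>k. \<bar>x k\<bar> powr r)"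
    by (rule summable_finite[OF assms(1)]) (simp add: assms(2))
  then show ?thesis by (simp add: lspace_def)
qed

lemma pairing_unit_sequence:
  obtains e where "e \<in> lspace s" "\<And>x. (\<Sum>i. x i * e i) = x k"
proof
  show "(\<lambda>i. if i = k then 1 else 0) \<in> lspace s"
    by (rule finite_support_in_lspace[of "{k}"]) auto
  show "(\<Sum>i. x i * (if i = k then 1 else 0)) = x k" for x :: "nat \<Rightarrow> real"
    using suminf_finite[of "{k}" "\<lambda>i. x i * (if i = k then 1 else 0)"] by simp
qed

section \<open>Norm boundedness by a gliding hump\<close>

text \<open>The equality case of Hoelder's inequality: for \<open>w\<close> proportional to
  \<open>sgn (a k) * \<bar>a k\<bar> powr (r - 1)\<close> with \<open>s\<close>-power sum
  \<open>\<delta>\<close>, the pairing equals \<open>\<delta> powr (1 / s) * S powr (1 / r)\<close>,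
  where \<open>S\<close> is the \<open>r\<close>-power sum of \<open>a\<close> over
  \<open>I\<close>. The threshold on \<open>S\<close> makes this at least \<open>T\<close>; its
  summand 1 keeps \<open>S\<close> positive even for \<open>T = 0\<close>.\<close>

lemma conjugate_norming_sequence:
  fixes a :: "nat \<Rightarrow> real" and T \<delta> :: real
  assumes rs: "1 < r" "1 < s" "1 / r + 1 / s = 1"
    and "0 < \<delta>" "0 \<le> T"
    and A: "1 + (T / \<delta> powr (1 / s)) powr r \<le> (\<Sum>k\<in>I. \<bar>a k\<bar> powr r)"
  obtains w where "\<And>k. k \<notin> I \<Longrightarrow> w k = 0" "(\<Sum>k\<in>I. \<bar>w k\<bar> powr s) = \<delta>"
    "T \<le> (\<Sum>k\<in>I. a k * w k)"
proof -
  define S where "S = (\<Sum>k\<in>I. \<bar>a k\<bar> powr r)"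
  have S: "1 + (T / \<delta> powr (1 / s)) powr r \<le> S" using A by (simp add: S_def)
  have "0 \<le> (T / \<delta> powr (1 / s)) powr r" by simp
  with S have S0: "0 < S" by linarith
  \<comment> \<open>Since \<open>(r - 1) * s = r\<close>, the unscaled candidate has
    \<open>s\<close>-power sum \<open>S\<close>; the factor \<open>c\<close> brings it to
    \<open>\<delta>\<close>.\<close>
  define c where "c = (\<delta> / S) powr (1 / s)"
  define w where "w = (\<lambda>k. if k \<in> I then c * (sgn (a k) * \<bar>a k\<bar> powr (r - 1)) else 0)"
  have c: "0 < c" "c powr s = \<delta> / S"
    using S0 assms by (simp_all add: c_def powr_powr)
  have rs': "(r - 1) * s = r" using rs by (simp add: field_simps)
  have 1: "\<bar>w k\<bar> powr s = \<delta> / S * \<bar>a k\<bar> powr r" if "k \<in> I" for k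
    using that c by (cases "a k = 0") (simp_all add: w_def abs_mult powr_mult powr_powr rs' abs_sgn_eq)
  have 2: "a k * w k = c * \<bar>a k\<bar> powr r" if "k \<in> I" for k
  proof (cases "a k = 0")
    case False
    have "a k * w k = c * (\<bar>a k\<bar> powr 1 * \<bar>a k\<bar> powr (r - 1))"
      using that False by (simp add: w_def abs_if)
    also have "\<dots> = c * \<bar>a k\<bar> powr r"
      by (simp only: powr_add[symmetric]) simp
    finally show ?thesis .
  qed simp
  have "(\<Sum>k\<in>I. \<bar>w k\<bar> powr s) = \<delta> / S * S"
    using 1 by (simp add: S_def sum_distrib_left)
  then have "(\<Sum>k\<in>I. \<bar>w k\<bar> powr s) = \<delta>" using S0 by simp
  moreover have "T \<le> (\<Sum>k\<in>I. a k * w k)"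
  proof -
    have "T / \<delta> powr (1 / s) = ((T / \<delta> powr (1 / s)) powr r) powr (1 / r)"
      using assms by (simp add: powr_powr)
    also have "\<dots> \<le> S powr (1 / r)"
      using S rs by (intro powr_mono2) auto
    finally have "T \<le> \<delta> powr (1 / s) * S powr (1 / r)"
      using \<open>0 < \<delta>\<close> by (simp add: divide_le_eq mult.commute)
    also have "S powr (1 / r) = S powr (1 + - (1 / s))"
    proof -
      have "1 / r = 1 + - (1 / s)" using rs(3) by linarith
      then show ?thesis by (simp only:)
    qed
    also have "\<dots> = S * S powr (- (1 / s))"
      using S0 by (subst powr_add) simp
    also have "\<delta> powr (1 / s) * (S * S powr (- (1 / s))) = c * S"
      using S0 \<open>0 < \<delta>\<close> by (simp add: c_def powr_divide powr_minus field_simps)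
    also have "\<dots> = (\<Sum>k\<in>I. a k * w k)"
      using 2 by (simp add: S_def sum_distrib_left)
    finally show ?thesis .
  qed
  ultimately show thesis
    using that[of w] by (simp add: w_def)
qed

text \<open>If the first \<open>M\<close> coordinates carry a mass bounded uniformly in
  \<open>n\<close>, a very large total mass must lie beyond \<open>M\<close>. Cutting where the
  remaining tail has mass at most 1 leaves a finite block heavy enough for a norming
  sequence.\<close>

lemma gliding_hump_step:
  fixes Z :: "nat \<Rightarrow> nat \<Rightarrow> real"
  assumes rs: "1 < r" "1 < s" "1 / r + 1 / s = 1"
    and Z: "\<And>n. Z n \<in> lspace r"
    and unbounded: "\<And>B. \<exists>n. B < (\<Sum>k. \<bar>Z n k\<bar> powr r)"
    and H: "\<And>n. (\<Sum>k<M. \<bar>Z n k\<bar> powr r) \<le> H"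
    and "0 \<le> T" "0 < \<delta>"
  shows "\<exists>n m w. M < m \<and> (\<forall>k. k \<notin> {M..<m} \<longrightarrow> w k = 0) \<and>
    (\<Sum>k\<in>{M..<m}. \<bar>w k\<bar> powr s) = \<delta> \<and> T \<le> (\<Sum>k\<in>{M..<m}. Z n k * w k) \<and>
    (\<Sum>k. \<bar>Z n (k + m)\<bar> powr r) \<le> 1"
proof -
  define A where "A = 1 + (T / \<delta> powr (1 / s)) powr r"
  \<comment> \<open>The budget is \<open>H\<close> for the head, 1 for the tail and
    \<open>A\<close>, the threshold of the norming sequence, for the block between them.\<close>
  obtain n where n: "H + A + 1 < (\<Sum>k. \<bar>Z n k\<bar> powr r)" using unbounded by blast
  have sm: "summable (\<lambda>k. \<bar>Z n k\<bar> powr r)" using Z by (simp add: lspace_def)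
  obtain N where N: "\<And>m. m \<ge> N \<Longrightarrow> norm (\<Sum>k. \<bar>Z n (k + m)\<bar> powr r) < 1"
    using suminf_exist_split[OF _ sm, of 1] by auto
  define m where "m = max N (Suc M)"
  have tail: "(\<Sum>k. \<bar>Z n (k + m)\<bar> powr r) \<le> 1" using N[of m] by (simp add: m_def)
  have "M < m" by (simp add: m_def)
  have "(\<Sum>k. \<bar>Z n k\<bar> powr r) = (\<Sum>k. \<bar>Z n (k + m)\<bar> powr r) + (\<Sum>k<m. \<bar>Z n k\<bar> powr r)"
    using suminf_split_initial_segment[OF sm, of m] .
  moreover have "(\<Sum>k<m. \<bar>Z n k\<bar> powr r) = (\<Sum>k<M. \<bar>Z n k\<bar> powr r) + (\<Sum>k\<in>{M..<m}. \<bar>Z n k\<bar> powr r)"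
    using sum.atLeastLessThan_concat[of 0 M m "\<lambda>k. \<bar>Z n k\<bar> powr r"] \<open>M < m\<close>
    by (simp add: atLeast0LessThan)
  ultimately have "A \<le> (\<Sum>k\<in>{M..<m}. \<bar>Z n k\<bar> powr r)"
    using n tail H[of n] by linarith
  then obtain w where "\<And>k. k \<notin> {M..<m} \<Longrightarrow> w k = 0"
    "(\<Sum>k\<in>{M..<m}. \<bar>w k\<bar> powr s) = \<delta>" "T \<le> (\<Sum>k\<in>{M..<m}. Z n k * w k)"
    by (rule conjugate_norming_sequence[OF rs \<open>0 < \<delta>\<close> \<open>0 \<le> T\<close>, folded A_def]) blast
  then show ?thesis using tail \<open>M < m\<close> by blast
qed

text \<open>In the proof the sum over all blocks stops at \<open>i = k\<close>, because \<open>i \<le> M i\<close> makes every later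
  block start beyond \<open>k\<close>.\<close>

lemma glue_blocks:
  fixes M :: "nat \<Rightarrow> nat" and w :: "nat \<Rightarrow> nat \<Rightarrow> 'a::comm_monoid_add"
  assumes M: "strict_mono M" and w: "\<And>j k. k \<notin> {M j..<M (Suc j)} \<Longrightarrow> w j k = 0"
  obtains y where "\<And>j k. k \<in> {M j..<M (Suc j)} \<Longrightarrow> y k = w j k"
proof
  fix j k assume k: "k \<in> {M j..<M (Suc j)}"
  have "j \<le> M j" using M by (rule strict_mono_imp_increasing)
  with k have "j \<in> {..k}" by auto
  have "w i k = 0" if "i \<noteq> j" for i
  proof (rule w)
    have "M (Suc i) \<le> M j \<or> M (Suc j) \<le> M i"
      using that M by (metis Suc_leI linorder_neq_iff strict_mono_less_eq)
    then show "k \<notin> {M i..<M (Suc i)}" using k by auto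
  qed
  then show "(\<Sum>i\<le>k. w i k) = w j k"
    using \<open>j \<in> {..k}\<close> by (subst sum.remove[of _ j]) auto
qed

text \<open>The uniform boundedness principle for these pairings. From an unbounded \<open>Z\<close>
  a single \<open>y\<close> in \<open>lspace s\<close> is assembled out of disjoint humps, so that
  its pairings with the members of \<open>Z\<close> are unbounded.\<close>

lemma weakly_bounded_imp_bounded:
  fixes Z :: "nat \<Rightarrow> nat \<Rightarrow> real"
  assumes rs: "1 < r" "1 < s" "1 / r + 1 / s = 1"
    and Z: "\<And>n. Z n \<in> lspace r"
    and bdd: "\<And>y. y \<in> lspace s \<Longrightarrow> \<exists>K. \<forall>n. \<bar>\<Sum>k. Z n k * y k\<bar> \<le> K"
  obtains B where "\<And>n. (\<Sum>k. \<bar>Z n k\<bar> powr r) \<le> B"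
proof (rule ccontr)
  assume "\<not> thesis"
  then have unbounded: "\<exists>n. B < (\<Sum>k. \<bar>Z n k\<bar> powr r)" for B
    using that by (meson not_le)
  have Zsm: "summable (\<lambda>k. \<bar>Z n k\<bar> powr r)" for n using Z by (simp add: lspace_def)
  \<comment> \<open>Testing against unit sequences bounds each coordinate uniformly in
    \<open>n\<close>; hence the bound \<open>H M\<close> on the mass of the first \<open>M\<close>
    coordinates does not depend on \<open>n\<close>.\<close>
  have "\<exists>K. \<forall>n. \<bar>Z n k\<bar> \<le> K" for k
  proof -
    obtain e where "e \<in> lspace s" and e: "\<And>x. (\<Sum>i. x i * e i) = x k"
      by (rule pairing_unit_sequence[of s k]) blast
    then show ?thesis using bdd[of e] by (simp only: e)
  qed
  then obtain C where C: "\<And>k n. \<bar>Z n k\<bar> \<le> C k" by metis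
  define H where "H M = (\<Sum>k<M. C k powr r)" for M
  have H: "(\<Sum>k<M. \<bar>Z n k\<bar> powr r) \<le> H M" for n M
    unfolding H_def using C rs by (intro sum_mono powr_mono2) auto
  have H0: "0 \<le> H M" for M unfolding H_def by (intro sum_nonneg) simp
  \<comment> \<open>The masses \<open>(1/2)^j\<close> are summable, which puts the glued sequence
    into \<open>lspace s\<close>. The target \<open>H M + real j\<close> offsets the possible loss
    \<open>H M\<close> on earlier coordinates and still grows with \<open>j\<close>.\<close>
  define hump where "hump j M n m w \<longleftrightarrow> M < m \<and> (\<forall>k. k \<notin> {M..<m} \<longrightarrow> w k = 0) \<and>
      (\<Sum>k\<in>{M..<m}. \<bar>w k\<bar> powr s) = (1/2)^j \<and> H M + real j \<le> (\<Sum>k\<in>{M..<m}. Z n k * w k) \<and>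
      (\<Sum>k. \<bar>Z n (k + m)\<bar> powr r) \<le> 1" for j M n m and w :: "nat \<Rightarrow> real"
  have "\<exists>n m w. hump j M n m w" for j M
  proof -
    have "0 \<le> H M + real j" "0 < (1/2::real)^j" using H0[of M] by simp_all
    then show ?thesis unfolding hump_def by (rule gliding_hump_step[OF rs Z unbounded H])
  qed
  then obtain n m w where "\<And>j M. hump j M (n j M) (m j M) (w j M)" by metis
  then have step: "\<And>j M. M < m j M"
      "\<And>j M k. k \<notin> {M..<m j M} \<Longrightarrow> w j M k = 0"
      "\<And>j M. (\<Sum>k\<in>{M..<m j M}. \<bar>w j M k\<bar> powr s) = (1/2)^j"
      "\<And>j M. H M + real j \<le> (\<Sum>k\<in>{M..<m j M}. Z (n j M) k * w j M k)"
      "\<And>j M. (\<Sum>k. \<bar>Z (n j M) (k + m j M)\<bar> powr r) \<le> 1"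
    unfolding hump_def by blast+
  \<comment> \<open>Humps exist from every starting point, so each block can begin exactly where the
    previous one ends; the blocks then partition the natural numbers.\<close>
  define M where "M = rec_nat 0 m"
  have M0: "M 0 = 0" and MSuc: "M (Suc j) = m j (M j)" for j by (simp_all add: M_def)
  have M: "strict_mono M" using step(1) by (simp add: strict_mono_Suc_iff MSuc)
  obtain y where y: "\<And>j k. k \<in> {M j..<M (Suc j)} \<Longrightarrow> y k = w j (M j) k"
    by (rule glue_blocks[OF M, of "\<lambda>j. w j (M j)"]) (use step(2) MSuc in auto)
  have "(\<Sum>k<M j. \<bar>y k\<bar> powr s) = (\<Sum>i<j. (1/2)^i)" for j
  proof (induction j)
    case (Suc j)
    have "(\<Sum>k<M (Suc j). \<bar>y k\<bar> powr s)
        = (\<Sum>k<M j. \<bar>y k\<bar> powr s) + (\<Sum>k\<in>{M j..<M (Suc j)}. \<bar>y k\<bar> powr s)"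
      using sum.atLeastLessThan_concat[of 0 "M j" "M (Suc j)" "\<lambda>k. \<bar>y k\<bar> powr s"] M
      by (simp add: atLeast0LessThan strict_mono_less_eq)
    also have "(\<Sum>k\<in>{M j..<M (Suc j)}. \<bar>y k\<bar> powr s) = (1/2)^j"
      using y[of _ j] step(3)[of j "M j"] by (simp add: MSuc)
    finally show ?case using Suc by simp
  qed (simp add: M0)
  moreover have "(\<Sum>i<j. (1/2::real)^i) \<le> 2" for j
    by (simp add: sum_gp_strict)
  ultimately have ypart: "(\<Sum>k<M j. \<bar>y k\<bar> powr s) \<le> 2" for j by simp
  have "(\<Sum>k\<le>N. \<bar>y k\<bar> powr s) \<le> 2" for N
  proof -
    have "Suc N \<le> M (Suc N)" using M by (rule strict_mono_imp_increasing)
    then have "(\<Sum>k\<le>N. \<bar>y k\<bar> powr s) \<le> (\<Sum>k<M (Suc N). \<bar>y k\<bar> powr s)"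
      by (intro sum_mono2) auto
    also have "\<dots> \<le> 2" by (rule ypart)
    finally show ?thesis .
  qed
  then have ysm: "summable (\<lambda>k. \<bar>y k\<bar> powr s)" by (intro bounded_imp_summable[of _ 2]) auto
  then have "y \<in> lspace s" by (simp add: lspace_def)
  then obtain K where K: "\<And>i. \<bar>\<Sum>k. Z i k * y k\<bar> \<le> K" using bdd by blast
  define Y where "Y = (\<Sum>k. \<bar>y k\<bar> powr s)"
  \<comment> \<open>For the index chosen at stage \<open>j\<close>, the head loses at most
    \<open>H (M j) + Y\<close> and the tail at most \<open>1 + Y\<close>, both by Young's
    inequality, while the block gains at least \<open>H (M j) + real j\<close>.\<close>
  have large: "real j - 1 - 2 * Y \<le> K" for j
  proof -
    define a where "a = Z (n j (M j))"
    define M' where "M' = M (Suc j)"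
    have "M j \<le> M'" using M by (simp add: M'_def strict_mono_less_eq)
    have asm: "summable (\<lambda>k. \<bar>a k\<bar> powr r)" using Zsm by (simp add: a_def)
    have ay: "summable (\<lambda>k. a k * y k)"
      using summable_abs_mult_conjugate(1)[OF rs asm ysm] by (rule summable_rabs_cancel)
    have tail: "- (1 + Y) \<le> (\<Sum>k. a (k + M') * y (k + M'))"
    proof -
      have "(\<Sum>k. \<bar>y (k + M')\<bar> powr s) \<le> Y"
        using suminf_split_initial_segment[OF ysm, of M'] by (simp add: Y_def sum_nonneg)
      moreover have "(\<Sum>k. \<bar>a (k + M')\<bar> powr r) \<le> 1"
        using step(5) by (simp add: a_def M'_def MSuc)
      moreover have "\<bar>\<Sum>k. a (k + M') * y (k + M')\<bar>
          \<le> (\<Sum>k. \<bar>a (k + M')\<bar> powr r) + (\<Sum>k. \<bar>y (k + M')\<bar> powr s)"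
        using asm ysm by (intro summable_abs_mult_conjugate(2)[OF rs])
          (auto simp: summable_iff_shift[of "\<lambda>k. \<bar>a k\<bar> powr r"] summable_iff_shift[of "\<lambda>k. \<bar>y k\<bar> powr s"])
      ultimately show ?thesis by linarith
    qed
    have head: "- (H (M j) + Y) \<le> (\<Sum>k<M j. a k * y k)"
    proof -
      have "\<bar>\<Sum>k<M j. a k * y k\<bar> \<le> (\<Sum>k<M j. \<bar>a k * y k\<bar>)" by (rule sum_abs)
      also have "\<dots> \<le> (\<Sum>k<M j. \<bar>a k\<bar> powr r + \<bar>y k\<bar> powr s)"
        by (intro sum_mono abs_mult_le_powr_add_powr rs)
      also have "\<dots> \<le> H (M j) + Y"
        unfolding sum.distrib a_def Y_def
        by (intro add_mono H sum_le_suminf ysm) auto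
      finally show ?thesis by linarith
    qed
    have "(\<Sum>k\<in>{M j..<M'}. a k * y k) = (\<Sum>k\<in>{M j..<M'}. a k * w j (M j) k)"
      using y[of _ j] by (intro sum.cong) (auto simp: M'_def)
    then have block: "H (M j) + real j \<le> (\<Sum>k\<in>{M j..<M'}. a k * y k)"
      using step(4)[of "M j" j] by (simp add: a_def M'_def MSuc)
    have "(\<Sum>k. a k * y k) = (\<Sum>k. a (k + M') * y (k + M')) + (\<Sum>k<M'. a k * y k)"
      using suminf_split_initial_segment[OF ay, of M'] by simp
    moreover have "(\<Sum>k<M'. a k * y k) = (\<Sum>k<M j. a k * y k) + (\<Sum>k\<in>{M j..<M'}. a k * y k)"
      using sum.atLeastLessThan_concat[of 0 "M j" M' "\<lambda>k. a k * y k"] \<open>M j \<le> M'\<close>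
      by (simp add: atLeast0LessThan)
    moreover have "\<bar>\<Sum>k. a k * y k\<bar> \<le> K" unfolding a_def by (rule K)
    ultimately show ?thesis using tail head block by linarith
  qed
  obtain j where "K + 1 + 2 * Y < real j" using reals_Archimedean2 by blast
  with large[of j] show False by linarith
qed

section \<open>Consequences of weak convergence\<close>

lemma weakly_converges_imp_bounded:
  assumes rs: "1 < r" "1 < s" "1 / r + 1 / s = 1" and W: "weakly_converges r Z z"
  obtains B where "\<And>n. (\<Sum>k. \<bar>Z n k\<bar> powr r) \<le> B"
proof (rule weakly_bounded_imp_bounded[OF rs, of Z])
  fix y assume "y \<in> lspace s"
  then have "(\<lambda>n. \<Sum>k. Z n k * y k) \<longlonglongrightarrow> (\<Sum>k. z k * y k)"
    using bounded_functional_pairing[OF rs] W by (auto simp: weakly_converges_def)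
  then have "Bseq (\<lambda>n. \<Sum>k. Z n k * y k)"
    by (intro convergent_imp_Bseq convergentI)
  then show "\<exists>K. \<forall>n. \<bar>\<Sum>k. Z n k * y k\<bar> \<le> K" by (auto simp: Bseq_def)
qed (use W that in \<open>auto simp: weakly_converges_def\<close>)

lemma weakly_converges_coordinate:
  assumes rs: "1 < r" "1 < s" "1 / r + 1 / s = 1" and W: "weakly_converges r Z z"
  shows "(\<lambda>n. Z n k) \<longlonglongrightarrow> z k"
proof -
  obtain e where "e \<in> lspace s" and e: "\<And>x. (\<Sum>i. x i * e i) = x k"
    by (rule pairing_unit_sequence[of s k]) blast
  then have "bounded_functional r (\<lambda>x. \<Sum>i. x i * e i)"
    by (intro bounded_functional_pairing[OF rs])
  then have "(\<lambda>n. \<Sum>i. Z n i * e i) \<longlonglongrightarrow> (\<Sum>i. z i * e i)"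
    using W unfolding weakly_converges_def by blast
  then show ?thesis by (simp add: e)
qed

section \<open>Inclusion between the sequence spaces\<close>

text \<open>Each term \<open>\<bar>x k\<bar> powr q\<close> is at most \<open>B\<close>, so raising
  the exponent to \<open>t\<close> costs at most the factor \<open>B powr (t / q - 1)\<close>. The
  bound depends on \<open>x\<close> only through \<open>B\<close>, hence is uniform over bounded
  families.\<close>

lemma suminf_powr_mono_exponent:
  fixes x :: "nat \<Rightarrow> real"
  assumes "0 < q" "q \<le> t" and x: "x \<in> lspace q" and B: "(\<Sum>k. \<bar>x k\<bar> powr q) \<le> B"
  shows "x \<in> lspace t" "(\<Sum>k. \<bar>x k\<bar> powr t) \<le> B powr (t / q - 1) * B"
proof -
  have xs: "summable (\<lambda>k. \<bar>x k\<bar> powr q)" using x by (simp add: lspace_def)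
  have le: "\<bar>x k\<bar> powr t \<le> B powr (t / q - 1) * \<bar>x k\<bar> powr q" for k
  proof -
    have "\<bar>x k\<bar> powr q \<le> (\<Sum>k. \<bar>x k\<bar> powr q)"
      using sum_le_suminf[OF xs, of "{k}"] by simp
    then have kB: "\<bar>x k\<bar> powr q \<le> B" using B by linarith
    have "\<bar>x k\<bar> powr t = (\<bar>x k\<bar> powr q) powr (t / q - 1 + 1)"
      using assms by (simp add: powr_powr)
    also have "\<dots> = (\<bar>x k\<bar> powr q) powr (t / q - 1) * \<bar>x k\<bar> powr q"
      by (subst powr_add) simp
    also have "\<dots> \<le> B powr (t / q - 1) * \<bar>x k\<bar> powr q"
      using kB assms by (intro mult_right_mono powr_mono2) auto
    finally show ?thesis .
  qed
  have sB: "summable (\<lambda>k. B powr (t / q - 1) * \<bar>x k\<bar> powr q)" using xs by (rule summable_mult)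
  have st: "summable (\<lambda>k. \<bar>x k\<bar> powr t)"
    by (rule summable_comparison_test'[OF sB, of 0]) (use le in simp)
  then show "x \<in> lspace t" by (simp add: lspace_def)
  have "(\<Sum>k. \<bar>x k\<bar> powr t) \<le> (\<Sum>k. B powr (t / q - 1) * \<bar>x k\<bar> powr q)"
    using le by (intro suminf_le st sB)
  also have "\<dots> = B powr (t / q - 1) * (\<Sum>k. \<bar>x k\<bar> powr q)" using xs by (rule suminf_mult)
  also have "\<dots> \<le> B powr (t / q - 1) * B" using B by (intro mult_left_mono) auto
  finally show "(\<Sum>k. \<bar>x k\<bar> powr t) \<le> B powr (t / q - 1) * B" .
qed

section \<open>Bounded functionals as coefficient sequences\<close>

lemma bounded_functional_add:
  "bounded_functional t \<phi> \<Longrightarrow> x \<in> lspace t \<Longrightarrow> y \<in> lspace t \<Longrightarrow>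
    \<phi> (\<lambda>k. x k + y k) = \<phi> x + \<phi> y"
  by (simp add: bounded_functional_def)

lemma bounded_functional_scale:
  "bounded_functional t \<phi> \<Longrightarrow> x \<in> lspace t \<Longrightarrow> \<phi> (\<lambda>k. c * x k) = c * \<phi> x"
  by (simp add: bounded_functional_def)

definition unit_seq :: "nat \<Rightarrow> nat \<Rightarrow> real" where
  "unit_seq k = (\<lambda>i. if i = k then 1 else 0)"

lemma bounded_functional_restrict_finite:
  assumes \<phi>: "bounded_functional t \<phi>" and "finite F"
  shows "\<phi> (\<lambda>i. if i \<in> F then x i else 0) = (\<Sum>k\<in>F. x k * \<phi> (unit_seq k))"
  using \<open>finite F\<close>
proof (induction F)
  case empty
  have "(\<lambda>i. 0) \<in> lspace t" by (rule finite_support_in_lspace[of "{}"]) auto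
  from bounded_functional_scale[OF \<phi> this, of 0]
  show ?case by simp
next
  case (insert k F)
  let ?u = "\<lambda>i. x k * unit_seq k i" and ?v = "\<lambda>i. if i \<in> F then x i else 0"
  have u: "unit_seq k \<in> lspace t" "?u \<in> lspace t"
    by (rule finite_support_in_lspace[of "{k}"]; simp add: unit_seq_def)+
  have v: "?v \<in> lspace t"
    using insert.hyps by (intro finite_support_in_lspace[of F]) auto
  have "\<phi> (\<lambda>i. ?u i + ?v i) = \<phi> ?u + \<phi> ?v" "\<phi> ?u = x k * \<phi> (unit_seq k)"
    by (rule bounded_functional_add[OF \<phi> u(2) v] bounded_functional_scale[OF \<phi> u(1)])+
  moreover have "(\<lambda>i. ?u i + ?v i) = (\<lambda>i. if i \<in> insert k F then x i else 0)"
    using insert.hyps by (auto simp: unit_seq_def fun_eq_iff)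
  ultimately show ?case using insert by simp
qed

text \<open>The truncations of \<open>x\<close> converge to \<open>x\<close> in
  \<open>lnorm t\<close>, because the tails of a convergent series vanish; boundedness of
  \<open>\<phi>\<close> carries this over to the images.\<close>

lemma bounded_functional_sums:
  assumes \<phi>: "bounded_functional t \<phi>" and t: "0 < t" and x: "x \<in> lspace t"
  shows "(\<lambda>k. x k * \<phi> (unit_seq k)) sums \<phi> x"
proof -
  obtain C where C: "\<And>x. x \<in> lspace t \<Longrightarrow> \<bar>\<phi> x\<bar> \<le> C * lnorm t x"
    using \<phi> unfolding bounded_functional_def by blast
  have xs: "summable (\<lambda>k. \<bar>x k\<bar> powr t)" using x by (simp add: lspace_def)
  define R where "R N = (\<Sum>k. \<bar>x (k + N)\<bar> powr t)" for N
  have "R = (\<lambda>N. (\<Sum>k. \<bar>x k\<bar> powr t) - (\<Sum>k<N. \<bar>x k\<bar> powr t))"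
    using suminf_split_initial_segment[OF xs] by (simp add: R_def fun_eq_iff algebra_simps)
  then have "R \<longlonglongrightarrow> 0"
    using tendsto_diff[OF tendsto_const summable_LIMSEQ[OF xs], of "\<Sum>k. \<bar>x k\<bar> powr t"]
    by simp
  moreover have "0 \<le> R N" for N
    unfolding R_def using xs
    by (intro suminf_nonneg) (auto simp: summable_iff_shift[of "\<lambda>k. \<bar>x k\<bar> powr t"])
  ultimately have "(\<lambda>N. R N powr (1 / t)) \<longlonglongrightarrow> 0"
    using t by (intro tendsto_zero_powrI[where b = "1 / t"]) auto
  then have lim: "(\<lambda>N. C * R N powr (1 / t)) \<longlonglongrightarrow> 0"
    by (rule tendsto_mult_right_zero)
  have bound: "\<bar>\<phi> x - (\<Sum>k<N. x k * \<phi> (unit_seq k))\<bar> \<le> C * R N powr (1 / t)" for N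
  proof -
    \<comment> \<open>\<open>\<phi>\<close> maps the head \<open>?h\<close> to the partial sum, so
      the error is \<open>\<phi> ?t\<close>, and the tail \<open>?t\<close> has norm
      \<open>R N powr (1 / t)\<close>.\<close>
    let ?h = "\<lambda>i. if i \<in> {..<N} then x i else 0" and ?t = "\<lambda>i. if i < N then 0 else x i"
    have h: "?h \<in> lspace t" by (rule finite_support_in_lspace[of "{..<N}"]) auto
    have shift: "(\<lambda>k. \<bar>?t (k + N)\<bar> powr t) = (\<lambda>k. \<bar>x (k + N)\<bar> powr t)" by auto
    have ts: "summable (\<lambda>k. \<bar>?t k\<bar> powr t)"
      using xs summable_iff_shift[of "\<lambda>k. \<bar>?t k\<bar> powr t" N]
        summable_iff_shift[of "\<lambda>k. \<bar>x k\<bar> powr t" N] by (simp only: shift)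
    then have tl: "?t \<in> lspace t" by (simp add: lspace_def)
    have "(\<Sum>k. \<bar>?t k\<bar> powr t) = R N"
      using suminf_split_initial_segment[OF ts, of N] unfolding shift R_def by simp
    then have "lnorm t ?t = R N powr (1 / t)" by (simp add: lnorm_def)
    with C[OF tl] have "\<bar>\<phi> ?t\<bar> \<le> C * R N powr (1 / t)" by simp
    moreover have "\<phi> (\<lambda>i. ?h i + ?t i) = \<phi> ?h + \<phi> ?t"
      by (rule bounded_functional_add[OF \<phi> h tl])
    moreover have "(\<lambda>i. ?h i + ?t i) = x" by auto
    ultimately show ?thesis
      using bounded_functional_restrict_finite[OF \<phi>, of "{..<N}" x] by simp
  qed
  have "(\<lambda>N. \<phi> x - (\<Sum>k<N. x k * \<phi> (unit_seq k))) \<longlonglongrightarrow> 0"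
    by (rule Lim_null_comparison[OF _ lim]) (use bound in simp)
  from tendsto_diff[OF tendsto_const this, of "\<phi> x"] show ?thesis by (simp add: sums_def)
qed

text \<open>Otherwise the sum of \<open>N\<close> signed unit vectors, of norm \<open>N powr (1 / t)\<close>, has an image that grows
  linearly in \<open>N\<close>.\<close>

lemma bounded_functional_unit_seq_tendsto_zero:
  assumes \<phi>: "bounded_functional t \<phi>" and t: "1 < t"
  shows "(\<lambda>k. \<phi> (unit_seq k)) \<longlonglongrightarrow> 0"
proof (rule ccontr)
  assume "\<not> ?thesis"
  then obtain \<epsilon> where \<epsilon>: "0 < \<epsilon>" and "\<forall>N. \<exists>k\<ge>N. \<epsilon> \<le> \<bar>\<phi> (unit_seq k)\<bar>"
    unfolding LIMSEQ_iff by (auto simp: not_less)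
  then have inf: "infinite {k. \<epsilon> \<le> \<bar>\<phi> (unit_seq k)\<bar>}"
    unfolding infinite_nat_iff_unbounded_le mem_Collect_eq by blast
  obtain C where C: "\<And>x. x \<in> lspace t \<Longrightarrow> \<bar>\<phi> x\<bar> \<le> C * lnorm t x"
    using \<phi> unfolding bounded_functional_def by blast
  have le: "\<epsilon> * real N \<le> C * real N powr (1 / t)" for N
  proof -
    obtain F where F: "finite F" "card F = N" "F \<subseteq> {k. \<epsilon> \<le> \<bar>\<phi> (unit_seq k)\<bar>}"
      using infinite_arbitrarily_large[OF inf] by blast
    define x where "x = (\<lambda>i. if i \<in> F then sgn (\<phi> (unit_seq i)) else 0)"
    have large: "\<epsilon> \<le> \<bar>\<phi> (unit_seq k)\<bar>" if "k \<in> F" for k using F(3) that by blast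
    have x: "x \<in> lspace t" using F(1) by (rule finite_support_in_lspace) (simp add: x_def)
    have "\<bar>x i\<bar> powr t = 1" if "i \<in> F" for i
      using large[OF that] that \<epsilon> by (simp add: x_def abs_sgn_eq)
    moreover have "\<bar>x i\<bar> powr t = 0" if "i \<notin> F" for i
      using that by (simp add: x_def)
    ultimately have "(\<Sum>i. \<bar>x i\<bar> powr t) = real N"
      using suminf_finite[OF F(1), of "\<lambda>i. \<bar>x i\<bar> powr t"] F(2) by simp
    then have norm: "lnorm t x = real N powr (1 / t)" by (simp add: lnorm_def)
    have "\<epsilon> * real N \<le> (\<Sum>k\<in>F. \<bar>\<phi> (unit_seq k)\<bar>)"
      using sum_bounded_below[of F \<epsilon> "\<lambda>k. \<bar>\<phi> (unit_seq k)\<bar>"] large F(2) by (simp add: mult.commute)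
    also have "\<dots> = \<phi> x"
      unfolding x_def bounded_functional_restrict_finite[OF \<phi> F(1)]
      by (intro sum.cong) (simp_all add: abs_sgn mult.commute)
    also have "\<dots> \<le> C * real N powr (1 / t)" using C[OF x] norm by simp
    finally show ?thesis .
  qed
  \<comment> \<open>Division by \<open>real N powr (1 / t)\<close> leaves the exponent
    \<open>1 - 1 / t\<close>, positive because \<open>1 < t\<close>, so the left side is unbounded
    in \<open>N\<close>.\<close>
  have upper: "\<epsilon> * real N powr (1 - 1 / t) \<le> C" if "N > 0" for N
  proof -
    have "real N powr (1 - 1 / t) * real N powr (1 / t) = real N"
      using that by (simp add: powr_add[symmetric])
    then have "\<epsilon> * real N powr (1 - 1 / t) * real N powr (1 / t) \<le> C * real N powr (1 / t)"
      using le[of N] by (simp only: mult.assoc)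
    then show ?thesis by (rule mult_right_le_imp_le) (use that in simp)
  qed
  have "filterlim (\<lambda>N. real N powr (1 - 1 / t)) at_top sequentially"
    by (rule filterlim_compose[OF real_powr_at_top filterlim_real_sequentially]) (use t in simp)
  then have "eventually (\<lambda>N. C / \<epsilon> < real N powr (1 - 1 / t)) sequentially"
    unfolding filterlim_at_top_dense by blast
  then have "eventually (\<lambda>N. C / \<epsilon> < real N powr (1 - 1 / t) \<and> 0 < N) sequentially"
    using eventually_gt_at_top by (rule eventually_conj)
  then obtain N where "C / \<epsilon> < real N powr (1 - 1 / t)" "0 < N"
    using eventually_happens'[OF sequentially_bot] by blast
  then have "C < \<epsilon> * real N powr (1 - 1 / t)"
    using \<epsilon> by (simp add: divide_less_eq mult.commute)
  with upper[OF \<open>0 < N\<close>] show False by linarith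
qed

section \<open>From coordinatewise to weak convergence\<close>

text \<open>Split at an index beyond which the weights \<open>c\<close> are small: the tail is small
  uniformly in \<open>n\<close> by the bound on absolute sums, and the head consists of finitely
  many convergent coordinates.\<close>

lemma tendsto_suminf_null_weight:
  fixes X :: "nat \<Rightarrow> nat \<Rightarrow> real"
  assumes c: "c \<longlonglongrightarrow> 0" and X: "\<And>k. (\<lambda>n. X n k) \<longlonglongrightarrow> x k"
    and sX: "\<And>n. summable (\<lambda>k. \<bar>X n k\<bar>)" and sx: "summable (\<lambda>k. \<bar>x k\<bar>)"
    and B: "\<And>n. (\<Sum>k. \<bar>X n k\<bar>) \<le> B"
  shows "(\<lambda>n. \<Sum>k. X n k * c k) \<longlonglongrightarrow> (\<Sum>k. x k * c k)"
proof -
  define D where "D n k = X n k - x k" for n k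
  define B' where "B' = B + (\<Sum>k. \<bar>x k\<bar>)"
  have sD: "summable (\<lambda>k. \<bar>D n k\<bar>)" for n
    by (rule summable_comparison_test'[OF summable_add[OF sX[of n] sx], of 0]) (simp add: D_def)
  have "(\<Sum>k. \<bar>D n k\<bar>) \<le> (\<Sum>k. \<bar>X n k\<bar> + \<bar>x k\<bar>)" for n
    by (intro suminf_le sD summable_add sX sx) (simp add: D_def)
  moreover have "(\<Sum>k. \<bar>X n k\<bar> + \<bar>x k\<bar>) \<le> B'" for n
    using B[of n] suminf_add[OF sX[of n] sx] by (simp add: B'_def)
  ultimately have DB: "(\<Sum>k. \<bar>D n k\<bar>) \<le> B'" for n
    by (rule order_trans)
  have B0: "0 \<le> B'" using suminf_nonneg[OF sD[of 0]] DB[of 0] by force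
  obtain L where L: "0 < L" "\<And>k. \<bar>c k\<bar> \<le> L"
    using convergent_imp_Bseq[OF convergentI[OF c]] by (auto simp: Bseq_def)
  have scale: "summable (\<lambda>k. \<bar>v k * c k\<bar>)" if "summable (\<lambda>k. \<bar>v k\<bar>)" for v
    by (rule summable_comparison_test'[OF summable_mult[OF that, of L], of 0])
      (use L in \<open>auto simp: abs_mult mult.commute intro: mult_right_mono\<close>)
  have "(\<lambda>n. \<Sum>k. D n k * c k) \<longlonglongrightarrow> 0"
  proof (rule LIMSEQ_I)
    fix \<epsilon> :: real assume "0 < \<epsilon>"
    \<comment> \<open>The added 1 covers \<open>B' = 0\<close> and makes
      \<open>\<eta> * B' < \<epsilon> / 2\<close> strict.\<close>
    define \<eta> where "\<eta> = \<epsilon> / (2 * (B' + 1))"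
    have \<eta>: "0 < \<eta>" "\<eta> * B' < \<epsilon> / 2"
      using \<open>0 < \<epsilon>\<close> B0 by (simp_all add: \<eta>_def field_simps)
    obtain N where N: "\<And>k. k \<ge> N \<Longrightarrow> \<bar>c k\<bar> < \<eta>"
      using LIMSEQ_D[OF c \<eta>(1)] by auto
    have "(\<lambda>n. \<Sum>k<N. D n k * c k) \<longlonglongrightarrow> (\<Sum>k<N. 0 * c k)"
      unfolding D_def using X by (intro tendsto_intros LIM_zero)
    then obtain n0 where n0: "\<And>n. n \<ge> n0 \<Longrightarrow> \<bar>\<Sum>k<N. D n k * c k\<bar> < \<epsilon> / 2"
      using LIMSEQ_D[of _ 0 "\<epsilon> / 2"] \<open>0 < \<epsilon>\<close> by fastforce
    have "\<bar>\<Sum>k. D n k * c k\<bar> < \<epsilon>" if "n \<ge> n0" for n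
    proof -
      have sDc: "summable (\<lambda>k. \<bar>D n k * c k\<bar>)" by (intro scale sD)
      have sh: "summable (\<lambda>k. \<bar>D n (k + N) * c (k + N)\<bar>)" "summable (\<lambda>k. \<bar>D n (k + N)\<bar>)"
        using sDc sD[of n] summable_iff_shift[of "\<lambda>k. \<bar>D n k * c k\<bar>" N]
          summable_iff_shift[of "\<lambda>k. \<bar>D n k\<bar>" N] by auto
      have "\<bar>\<Sum>k. D n (k + N) * c (k + N)\<bar> \<le> (\<Sum>k. \<bar>D n (k + N) * c (k + N)\<bar>)"
        using sh(1) by (rule summable_rabs)
      also have "\<dots> \<le> (\<Sum>k. \<eta> * \<bar>D n (k + N)\<bar>)"
        using less_imp_le[OF N] by (intro suminf_le sh summable_mult)
          (auto simp: abs_mult mult.commute intro!: mult_right_mono)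
      also have "\<dots> = \<eta> * (\<Sum>k. \<bar>D n (k + N)\<bar>)" using sh(2) by (rule suminf_mult)
      also have "\<dots> \<le> \<eta> * B'"
      proof (rule mult_left_mono)
        have "0 \<le> (\<Sum>k<N. \<bar>D n k\<bar>)" by (rule sum_nonneg) simp
        then show "(\<Sum>k. \<bar>D n (k + N)\<bar>) \<le> B'"
          using suminf_split_initial_segment[OF sD[of n], of N] DB[of n] by linarith
      qed (use \<eta>(1) in simp)
      finally have "\<bar>\<Sum>k. D n (k + N) * c (k + N)\<bar> < \<epsilon> / 2" using \<eta>(2) by simp
      with n0[OF that] show ?thesis
        using suminf_split_initial_segment[OF summable_rabs_cancel[OF sDc], of N] by linarith
    qed
    then show "\<exists>n0. \<forall>n\<ge>n0. norm ((\<Sum>k. D n k * c k) - 0) < \<epsilon>" by auto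
  qed
  moreover have "(\<Sum>k. D n k * c k) = (\<Sum>k. X n k * c k) - (\<Sum>k. x k * c k)" for n
    using suminf_diff[OF summable_rabs_cancel[OF scale[OF sX[of n]]] summable_rabs_cancel[OF scale[OF sx]]]
    by (simp only: D_def left_diff_distrib)
  ultimately show ?thesis by (simp add: LIM_zero_iff)
qed

text \<open>Here \<open>q \<le> 1\<close> yields the uniform bound on absolute sums, and
  \<open>1 < t\<close> makes the coefficients of every bounded functional tend to zero.\<close>

lemma weakly_converges_if_bounded_coordinatewise:
  assumes t: "1 < t" and q: "0 < q" "q \<le> 1"
    and X: "\<And>n. X n \<in> lspace q" and x: "x \<in> lspace q"
    and B: "\<And>n. (\<Sum>k. \<bar>X n k\<bar> powr q) \<le> B"
    and lim: "\<And>k. (\<lambda>n. X n k) \<longlonglongrightarrow> x k"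
  shows "weakly_converges t X x"
proof -
  have Xt: "X n \<in> lspace t" for n using suminf_powr_mono_exponent(1)[of q t "X n" B] X B t q by auto
  have xt: "x \<in> lspace t" using suminf_powr_mono_exponent(1)[of q t x] x t q by auto
  have 1: "v \<in> lspace 1 \<longleftrightarrow> summable (\<lambda>k. \<bar>v k\<bar>)" for v by (simp add: lspace_def)
  have X1: "summable (\<lambda>k. \<bar>X n k\<bar>)" for n
    using suminf_powr_mono_exponent(1)[of q 1 "X n" B] X B q 1 by auto
  have x1: "summable (\<lambda>k. \<bar>x k\<bar>)"
    using suminf_powr_mono_exponent(1)[of q 1 x] x q 1 by auto
  have B1: "(\<Sum>k. \<bar>X n k\<bar>) \<le> B powr (1 / q - 1) * B" for n
    using suminf_powr_mono_exponent(2)[of q 1 "X n" B] X B q by simp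
  have "(\<lambda>n. \<phi> (X n)) \<longlonglongrightarrow> \<phi> x" if \<phi>: "bounded_functional t \<phi>" for \<phi>
  proof -
    have "\<phi> v = (\<Sum>k. v k * \<phi> (unit_seq k))" if "v \<in> lspace t" for v
      using bounded_functional_sums[OF \<phi> _ that] t by (simp add: sums_iff)
    then show ?thesis
      using tendsto_suminf_null_weight[OF bounded_functional_unit_seq_tendsto_zero[OF \<phi> t]
          lim X1 x1 B1] Xt xt by simp
  qed
  then show ?thesis using Xt xt by (simp add: weakly_converges_def)
qed

section \<open>The map \<open>psi\<close> and the conclusion\<close>

lemma abs_psi_powr:
  assumes "0 < p"
  shows "\<bar>psi p z k\<bar> powr q = \<bar>z k\<bar> powr (q / p)"
  by (cases "z k = 0") (simp_all add: psi_def abs_mult abs_sgn_eq powr_powr)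

text \<open>The signed power is continuous although \<open>sgn\<close> jumps at 0: there its
  absolute value \<open>\<bar>Z n k\<bar> powr (1 / p)\<close> squeezes it to 0, and away from 0
  every factor is continuous.\<close>

lemma tendsto_psi:
  assumes "0 < p" "(\<lambda>n. Z n k) \<longlonglongrightarrow> z k"
  shows "(\<lambda>n. psi p (Z n) k) \<longlonglongrightarrow> psi p z k"
proof (cases "z k = 0")
  case True
  then have "(\<lambda>n. \<bar>Z n k\<bar> powr (1 / p)) \<longlonglongrightarrow> 0"
    using assms by (intro tendsto_zero_powrI[where b = "1 / p"]) (auto simp: tendsto_rabs_zero)
  then have "(\<lambda>n. psi p (Z n) k) \<longlonglongrightarrow> 0"
    by (rule Lim_null_comparison[rotated]) (simp add: psi_def abs_mult abs_sgn_eq)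
  with True show ?thesis by (simp add: psi_def)
next
  case False
  then show ?thesis unfolding psi_def
    using assms by (intro tendsto_intros) auto
qed

theorem lemma3p2:
  fixes p q \<beta> :: real
  assumes "0 < p" and "p < q" and "q \<le> 1"
    and "\<beta> = q / (q - p)"
  shows "psi p \<in> lspace (q / p) \<rightarrow> lspace \<beta> \<and>
    (\<forall>(Z :: nat \<Rightarrow> nat \<Rightarrow> real) z.
       weakly_converges (q / p) Z z \<longrightarrow> weakly_converges \<beta> (\<lambda>n. psi p (Z n)) (psi p z))"
proof -
  \<comment> \<open>Conjugacy reads \<open>p / q + (q - p) / q = 1\<close>. The exponent
    \<open>\<beta>\<close> serves twice: as the dual exponent for testing in the domain and as the
    exponent of the target.\<close>
  have rs: "1 < q / p" "1 < \<beta>" "1 / (q / p) + 1 / \<beta> = 1"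
    using assms by (simp_all add: less_divide_eq add_divide_distrib[symmetric])
  have q: "0 < q" "q \<le> \<beta>" using assms rs(2) by linarith+
  have psi_q: "psi p z \<in> lspace q \<longleftrightarrow> z \<in> lspace (q / p)" for z
    using \<open>0 < p\<close> by (simp add: lspace_def abs_psi_powr)
  have "psi p z \<in> lspace \<beta>" if "z \<in> lspace (q / p)" for z
    using suminf_powr_mono_exponent(1)[OF q, of "psi p z"] that psi_q by auto
  moreover have "weakly_converges \<beta> (\<lambda>n. psi p (Z n)) (psi p z)"
    if W: "weakly_converges (q / p) Z z" for Z z
  proof -
    obtain B where B: "\<And>n. (\<Sum>k. \<bar>Z n k\<bar> powr (q / p)) \<le> B"
      using weakly_converges_imp_bounded[OF rs W] by blast
    show ?thesis
    proof (rule weakly_converges_if_bounded_coordinatewise[OF rs(2) q(1) \<open>q \<le> 1\<close>])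
      show "(\<lambda>n. psi p (Z n) k) \<longlonglongrightarrow> psi p z k" for k
        using \<open>0 < p\<close> weakly_converges_coordinate[OF rs W] by (rule tendsto_psi)
      show "(\<Sum>k. \<bar>psi p (Z n) k\<bar> powr q) \<le> B" for n
        using B \<open>0 < p\<close> by (simp add: abs_psi_powr)
    qed (use W psi_q in \<open>auto simp: weakly_converges_def\<close>)
  qed
  ultimately show ?thesis by blast
qed

end
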